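(* Let $\mu$ be a non-atomic and locally finite Borel measure on $\mathbb{R}^d$ with $\mu(R)=0$, and let $0<\theta\le1$. Suppose that $(E_n)_{n\ge1}$ is a sequence of sets in $\mathscr{G}_\mu^\theta$. Then $\bigcap_nE_n\in\mathscr{G}_\mu^\theta$.
   Context: Fix a point $P=(p_1,\dots,p_d)\in\mathbb{R}^d$. For $n\in\mathbb{Z}$, $\mathscr{D}_n$ is the collection of half-open cubes $\prod_{i=1}^d[p_i+n_i2^{-n},\,p_i+(n_i+1)2^{-n})$ with $n_1,\dots,n_d\in\mathbb{Z}$, and $\mathscr{D}=\bigcup_{n\in\mathbb{Z}}\mathscr{D}_n$ (dyadic cubes). $R=\bigcup_{n\in\mathbb{Z}}\bigcup_{D\in\mathscr{D}_n}\partial D$ is the union of all boundaries of dyadic cubes. For $0<\theta\le1$ and $E\subset\mathbb{R}^d$, $\mathscr{M}_\mu^\theta(E)=\inf\{\sum_k\mu(D_k)^\theta : D_k\in\mathscr{D},\ E\subset\bigcup_kD_k\}$ (infimum over countable covers by dyadic cubes). For $0<\theta\le1$, a set $E\subset\mathbb{R}^d$ belongs to the class $\mathscr{G}_\mu^\theta$ if $E$ is a $G_\delta$-set and $\mathscr{M}_\mu^\eta(E\cap D)=\mathscr{M}_\mu^\eta(D)$ for every $0<\eta<\theta$ and every $D\in\mathscr{D}$. *)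

theory Defs
  imports "HOL-Analysis.Analysis"
begin

definition dyadic_cube :: "real^'d \<Rightarrow> int \<Rightarrow> int^'d \<Rightarrow> (real^'d) set" where
  "dyadic_cube P n m =
     {x. \<forall>i. P $ i + of_int (m $ i) * 2 powi (- n) \<le> x $ i
           \<and> x $ i < P $ i + (of_int (m $ i) + 1) * 2 powi (- n)}"

definition dyadic_cubes_level :: "real^'d \<Rightarrow> int \<Rightarrow> (real^'d) set set" where
  "dyadic_cubes_level P n = range (dyadic_cube P n)"

definition dyadic_cubes :: "real^'d \<Rightarrow> (real^'d) set set" where
  "dyadic_cubes P = (\<Union>n. dyadic_cubes_level P n)"

definition dyadic_boundary :: "real^'d \<Rightarrow> (real^'d) set" where
  "dyadic_boundary P = (\<Union>n. \<Union>D\<in>dyadic_cubes_level P n. frontier D)"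

definition nonatomic :: "'a measure \<Rightarrow> bool" where
  "nonatomic M \<longleftrightarrow>
     (\<forall>A\<in>sets M. emeasure M A > 0 \<longrightarrow>
        (\<exists>B\<in>sets M. B \<subseteq> A \<and> 0 < emeasure M B \<and> emeasure M B < emeasure M A))"

definition locally_finite_measure :: "'a::topological_space measure \<Rightarrow> bool" where
  "locally_finite_measure M \<longleftrightarrow>
     (\<forall>x. \<exists>U. open U \<and> x \<in> U \<and> emeasure M U < \<infinity>)"

text \<open>Real powers on \<^typ>\<open>ennreal\<close> for positive exponents, so that \<open>\<infinity>\<close> is sent to \<open>\<infinity>\<close>
  and \<open>0\<close> to \<open>0\<close>.\<close>

definition ennreal_powr :: "ennreal \<Rightarrow> real \<Rightarrow> ennreal" where
  "ennreal_powr a t = (if a = \<infinity> then \<infinity> else ennreal (enn2real a powr t))"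

text \<open>Covers are countable families of dyadic cubes, finite and empty ones included. They are
  given as sets of cubes: repeating a cube in a cover can only increase the sum, so this yields
  the same infimum as indexed families.\<close>

definition dyadic_content ::
  "real^'d \<Rightarrow> (real^'d) measure \<Rightarrow> real \<Rightarrow> (real^'d) set \<Rightarrow> ennreal" where
  "dyadic_content P \<mu> \<theta> E =
     (INF C \<in> {C. countable C \<and> C \<subseteq> dyadic_cubes P \<and> E \<subseteq> \<Union>C}.
        (\<Sum>\<^sub>\<infinity>D\<in>C. ennreal_powr (emeasure \<mu> D) \<theta>))"

definition large_intersection_class ::
  "real^'d \<Rightarrow> (real^'d) measure \<Rightarrow> real \<Rightarrow> (real^'d) set set" where
  "large_intersection_class P \<mu> \<theta> =
     {E. gdelta E \<and>
         (\<forall>\<eta> D. 0 < \<eta> \<and> \<eta> < \<theta> \<and> D \<in> dyadic_cubes P \<longrightarrow>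
            dyadic_content P \<mu> \<eta> (E \<inter> D) = dyadic_content P \<mu> \<eta> D)}"

end

theory Submission
  imports Defs
begin

text \<open>
For \<open>\<eta> \<le> 1\<close> the function \<open>x \<mapsto> x powr \<eta>\<close> is subadditive, so the cheapest cover of a dyadic cube
is the cube itself, and it stays the cheapest when only almost every point of the cube has to be
covered (\<open>cost_le_cover\<close>). Hence a set \<open>E\<close> with the large intersection property behaves like a set
of full measure: intersecting a cube with \<open>E\<close>, or with the complement of a null set, does not change
the content of the cube.

The content is not additive, so a substitute is needed to pass from cubes to other sets. Since
dyadic cubes are nested or disjoint, two covers can be rearranged into a cover of the union and a
cover of the intersection. This makes the content strongly subadditive
(\<open>content_strongly_subadditive\<close>) and continuous along increasing unions
(\<open>content_incseq_Union_le\<close>), which is proved for abstract nets of sets. It follows that full content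
in every cube implies full content in every open set (\<open>content_trace_Union\<close>).

The intersection of countably many \<open>G\<^sub>\<delta>\<close> sets of full content in every cube is then treated as in
the Baire category theorem. Write it as an intersection of open sets \<open>G n\<close> and add to these the
complements of the frontiers of the dyadic cubes, which have full content because the frontiers are
null sets. Inside a cube \<open>D\<close> one finds nested open sets \<open>V n\<close> with \<open>closure (V (Suc n)) \<subseteq> V n \<inter> G n\<close>
whose contents all exceed a prescribed number below the content of \<open>D\<close> (\<open>shrink_open\<close>). They shrink
to a compact subset of the intersection that meets no boundary of a cube. A cover of it by
half-open cubes is therefore a cover by their interiors, so it covers some \<open>V n\<close> and cannot be
cheap (\<open>content_INT_open\<close>).
\<close>

section \<open>Sums in the extended nonnegative reals\<close>

lemma infsum_mono_subset_ennreal: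
  fixes f :: "'a \<Rightarrow> ennreal"
  assumes "A \<subseteq> B"
  shows "infsum f A \<le> infsum f B"
  by (rule infsum_mono_neutral) (use assms in \<open>auto intro: nonneg_summable_on_complete\<close>)

lemma infsum_member_le_ennreal:
  fixes f :: "'a \<Rightarrow> ennreal"
  assumes "x \<in> A"
  shows "f x \<le> infsum f A"
  using infsum_mono_subset_ennreal[of "{x}" A f] assms by simp

lemma infsum_Un_Int_ennreal:
  fixes f :: "'a \<Rightarrow> ennreal"
  shows "infsum f A + infsum f B = infsum f (A \<union> B) + infsum f (A \<inter> B)"
proof -
  have s: "f summable_on X" for X by (auto intro: nonneg_summable_on_complete)
  have "infsum f (A \<union> B) = infsum f A + infsum f (B - A)"
    using infsum_Un_disjoint[OF s s, of A "B - A"] by simp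
  moreover have "(B - A) \<union> (A \<inter> B) = B" "(B - A) \<inter> (A \<inter> B) = {}" by auto
  then have "infsum f B = infsum f (B - A) + infsum f (A \<inter> B)"
    using infsum_Un_disjoint[OF s s, of "B - A" "A \<inter> B"] by simp
  ultimately show ?thesis by (simp add: add_ac)
qed

text \<open>Continuity from below of the sum as a set function of its index set. This is what turns bounds
for finitely many covers into a bound for the limit cover in \<open>content_incseq_Union_le\<close>.\<close>
lemma infsum_le_incseq_ennreal:
  fixes f :: "'a \<Rightarrow> ennreal"
  assumes "incseq H" and "Z \<subseteq> (\<Union>k. H k)"
    and "\<And>k. infsum f (Z \<inter> H k) \<le> b"
  shows "infsum f Z \<le> b"
proof (rule infsum_le_finite_sums)
  show "f summable_on Z" by (auto intro: nonneg_summable_on_complete)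
  fix F assume F: "finite F" "F \<subseteq> Z"
  have "\<forall>x\<in>F. \<exists>k. x \<in> H k" using F assms(2) by auto
  then obtain g where g: "\<And>x. x \<in> F \<Longrightarrow> x \<in> H (g x)" by metis
  \<comment> \<open>The \<open>0\<close> only keeps the set nonempty when \<open>F\<close> is empty.\<close>
  define k where "k = Max (insert 0 (g ` F))"
  have "x \<in> H k" if "x \<in> F" for x
    using g[OF that] F(1) that incseqD[OF assms(1), of "g x" k] by (auto simp: k_def)
  then have "F \<subseteq> H k" ..
  then have "sum f F \<le> infsum f (Z \<inter> H k)"
    using infsum_mono_subset_ennreal[of F "Z \<inter> H k" f] F by simp
  then show "sum f F \<le> b" using assms(3) by (rule order_trans)
qed

lemma countable_exhaustion:
  assumes "countable C"
  obtains F :: "nat \<Rightarrow> 'a set"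
  where "incseq F" "\<And>n. finite (F n)" "(\<Union>n. F n) = C"
proof
  let ?F = "\<lambda>n. C \<inter> {x. to_nat_on C x \<le> n}"
  show "incseq ?F" by (rule monoI) auto
  show "finite (?F n)" for n
  proof (rule finite_imageD)
    show "finite (to_nat_on C ` ?F n)" by (rule finite_subset[of _ "{..n}"]) auto
    show "inj_on (to_nat_on C) (?F n)"
      using inj_on_to_nat_on[OF assms] by (rule inj_on_subset) auto
  qed
  show "(\<Union>n. ?F n) = C" by auto
qed

lemma emeasure_le_infsum_cover:
  assumes "countable C" "C \<subseteq> sets M" "A \<subseteq> \<Union>C"
  shows "emeasure M A \<le> infsum (emeasure M) C"
proof -
  obtain F where F: "incseq F" "\<And>n. finite (F n)" "(\<Union>n. F n) = C"
    using countable_exhaustion[OF assms(1)] by blast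
  have sF: "F n \<subseteq> sets M" for n using F(3) assms(2) by auto
  have mF: "\<Union>(F n) \<in> sets M" for n
    using F(2) sF by (intro sets.finite_Union) auto
  have "incseq (\<lambda>n. \<Union>(F n))"
    using F(1) by (intro monoI Union_mono) (auto dest: monoD)
  have "emeasure M A \<le> emeasure M (\<Union>C)"
    using assms by (intro emeasure_mono sets.countable_Union) auto
  also have "\<Union>C = (\<Union>n. \<Union>(F n))" using F(3) by auto
  also have "emeasure M (\<Union>n. \<Union>(F n)) = (SUP n. emeasure M (\<Union>(F n)))"
    using mF \<open>incseq (\<lambda>n. \<Union>(F n))\<close> by (intro SUP_emeasure_incseq[symmetric]) auto
  also have "\<dots> \<le> infsum (emeasure M) C"
  proof (rule SUP_least)
    fix n
    have "emeasure M (\<Union>(F n)) \<le> (\<Sum>Q\<in>F n. emeasure M Q)"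
      using emeasure_subadditive_finite[of "F n" "\<lambda>Q. Q" M] F(2) sF by auto
    also have "\<dots> \<le> infsum (emeasure M) C"
      using infsum_mono_subset_ennreal[of "F n" C "emeasure M"] F(2)[of n] F(3) by auto
    finally show "emeasure M (\<Union>(F n)) \<le> infsum (emeasure M) C" .
  qed
  finally show ?thesis .
qed

section \<open>Contents on a net\<close>

text \<open>The increasing sets lemma and strong subadditivity are combinatorial: they hold for the content
of any family of sets in which two members are nested or disjoint and every member lies below
only finitely many others. The dyadic cubes contained in a fixed cube form such a family. The
family of all dyadic cubes does not, since every cube has infinitely many ancestors; this is why
contents are studied inside one cube at a time.\<close>
locale net =
  fixes T :: "'a set set" and c :: "'a set \<Rightarrow> ennreal"
  assumes laminar: "\<lbrakk>Q \<in> T; Q' \<in> T; Q \<inter> Q' \<noteq> {}\<rbrakk> \<Longrightarrow> Q \<subseteq> Q' \<or> Q' \<subseteq> Q"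
    and finite_above: "Q \<in> T \<Longrightarrow> finite {Q' \<in> T. Q \<subseteq> Q'}"
    and finite_cost: "Q \<in> T \<Longrightarrow> c Q < \<infinity>"
begin

definition net_content :: "'a set \<Rightarrow> ennreal" where
  "net_content A = (INF C \<in> {C. C \<subseteq> T \<and> A \<subseteq> \<Union>C}. infsum c C)"

text \<open>In a net the maximal members of a family are pairwise disjoint and, by \<open>finite_above\<close>, have the
same union as the family. Passing to them is the canonical way to thin out a cover.\<close>
definition maximal :: "'a set set \<Rightarrow> 'a set set" where
  "maximal C = {Q \<in> C. \<forall>Q' \<in> C. Q \<subseteq> Q' \<longrightarrow> Q' = Q}"

lemma content_le: "\<lbrakk>C \<subseteq> T; A \<subseteq> \<Union>C\<rbrakk> \<Longrightarrow> net_content A \<le> infsum c C"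
  unfolding net_content_def by (rule INF_lower) auto

lemma content_mono: "A \<subseteq> B \<Longrightarrow> net_content A \<le> net_content B"
  unfolding net_content_def by (rule INF_superset_mono) auto

lemma content_net_finite: "Q \<in> T \<Longrightarrow> net_content Q < \<infinity>"
  using content_le[of "{Q}" Q] finite_cost[of Q] by auto

lemma near_optimal_cover:
  assumes "net_content A < \<infinity>" "0 < e"
  shows "\<exists>C. C \<subseteq> T \<and> A \<subseteq> \<Union>C \<and> infsum c C \<le> net_content A + ennreal e"
proof -
  have "net_content A < net_content A + ennreal e"
    using assms by (cases "net_content A") (auto simp flip: ennreal_plus intro!: ennreal_lessI)
  then show ?thesis
    unfolding net_content_def[of A] INF_less_iff by (auto intro: less_imp_le)
qed

lemma le_maximal:
  assumes "C \<subseteq> T" "Q \<in> C"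
  obtains R where "R \<in> maximal C" "Q \<subseteq> R"
proof -
  have "finite {R \<in> C. Q \<subseteq> R}"
    by (rule finite_subset[OF _ finite_above[of Q]]) (use assms in auto)
  moreover have "Q \<in> {R \<in> C. Q \<subseteq> R}" using assms by simp
  ultimately have "\<exists>R \<in> {R \<in> C. Q \<subseteq> R}. Q \<subseteq> R \<and> (\<forall>R' \<in> {R \<in> C. Q \<subseteq> R}. R \<subseteq> R' \<longrightarrow> R = R')"
    using finite_has_maximal2[of "{R \<in> C. Q \<subseteq> R}" Q] by blast
  then obtain R where "R \<in> C" "Q \<subseteq> R" "\<forall>R' \<in> {R \<in> C. Q \<subseteq> R}. R \<subseteq> R' \<longrightarrow> R = R'" by blast
  then have "R \<in> maximal C" "Q \<subseteq> R" unfolding maximal_def by auto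
  then show ?thesis by (rule that)
qed

lemma maximal_subset: "maximal C \<subseteq> C"
  by (auto simp: maximal_def)

lemma Union_maximal:
  assumes "C \<subseteq> T"
  shows "\<Union>(maximal C) = \<Union>C"
proof (rule equalityI)
  show "\<Union>C \<subseteq> \<Union>(maximal C)"
  proof
    fix x assume "x \<in> \<Union>C"
    then obtain Q where "Q \<in> C" "x \<in> Q" by blast
    then show "x \<in> \<Union>(maximal C)" using le_maximal[OF assms, of Q] by blast
  qed
qed (use maximal_subset in blast)

text \<open>Adding covers one at a time and thinning out after each step gives the same result as thinning
out once at the end.\<close>
lemma maximal_absorb:
  assumes "B \<subseteq> T" "C \<subseteq> T"
  shows "maximal (maximal B \<union> C) = maximal (B \<union> C)"
proof (rule equalityI; rule subsetI)
  fix Q assume Q: "Q \<in> maximal (maximal B \<union> C)"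
  have "Q' = Q" if "Q' \<in> B \<union> C" "Q \<subseteq> Q'" for Q'
  proof (cases "Q' \<in> C")
    case True
    then show ?thesis using Q that by (auto simp: maximal_def)
  next
    case False
    then have "Q' \<in> B" using that by simp
    then obtain R where "R \<in> maximal B" "Q' \<subseteq> R" using le_maximal[OF assms(1)] by blast
    then have "R = Q" using Q that by (auto simp: maximal_def)
    then show ?thesis using \<open>Q' \<subseteq> R\<close> that by auto
  qed
  then show "Q \<in> maximal (B \<union> C)" using Q by (auto simp: maximal_def)
next
  fix Q assume "Q \<in> maximal (B \<union> C)"
  then show "Q \<in> maximal (maximal B \<union> C)" by (auto simp: maximal_def)
qed

text \<open>The sum over two covers together counts the members of \<open>B \<union> C\<close> once and those of \<open>B \<inter> C\<close> once more.
The maximal members cover \<open>\<Union>B \<union> \<Union>C\<close>, and what is left over still covers \<open>\<Union>B \<inter> \<Union>C\<close>: a point in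
both unions lies in a member of each cover, these two are nested, and the smaller one is either
not maximal or common to both covers.\<close>
lemma cost_maximal_Un:
  assumes "B \<subseteq> T" "C \<subseteq> T"
  shows "infsum c (maximal (B \<union> C)) + net_content (\<Union>B \<inter> \<Union>C) \<le> infsum c B + infsum c C"
proof -
  define X where "X = maximal (B \<union> C)"
  define Y where "Y = ((B \<union> C) - X) \<union> (B \<inter> C)"
  have cover: "\<Union>B \<inter> \<Union>C \<subseteq> \<Union>Y"
  proof
    fix x assume "x \<in> \<Union>B \<inter> \<Union>C"
    then obtain Q Q' where Q: "Q \<in> B" "Q' \<in> C" "x \<in> Q" "x \<in> Q'" by auto
    then have "Q \<subseteq> Q' \<or> Q' \<subseteq> Q" using laminar assms by blast
    then have "Q \<in> Y \<or> Q' \<in> Y"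
      using Q unfolding Y_def X_def maximal_def by auto
    then show "x \<in> \<Union>Y" using Q by auto
  qed
  have Y: "Y \<subseteq> T" using assms by (auto simp: Y_def)
  have "X \<union> Y = B \<union> C" "X \<inter> Y \<subseteq> B \<inter> C"
    using maximal_subset by (auto simp: X_def Y_def)
  have "infsum c X + net_content (\<Union>B \<inter> \<Union>C) \<le> infsum c X + infsum c Y"
    using content_le[OF Y cover] by (rule add_left_mono)
  also have "\<dots> = infsum c (B \<union> C) + infsum c (X \<inter> Y)"
    using infsum_Un_Int_ennreal[of c X Y] \<open>X \<union> Y = _\<close> by simp
  also have "\<dots> \<le> infsum c (B \<union> C) + infsum c (B \<inter> C)"
    using \<open>X \<inter> Y \<subseteq> _\<close> by (intro add_left_mono infsum_mono_subset_ennreal)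
  also have "\<dots> = infsum c B + infsum c C"
    using infsum_Un_Int_ennreal[of c B C] by simp
  finally show ?thesis unfolding X_def .
qed

text \<open>Near-optimal covers of \<open>A\<close> and \<open>B\<close>, redistributed by \<open>cost_maximal_Un\<close>.\<close>
lemma content_strongly_subadditive:
  "net_content (A \<union> B) + net_content (A \<inter> B) \<le> net_content A + net_content B"
proof (cases "net_content A < \<infinity> \<and> net_content B < \<infinity>")
  case True
  show ?thesis
  proof (rule ennreal_le_epsilon)
    fix e :: real assume "0 < e"
    obtain C where C: "C \<subseteq> T" "A \<subseteq> \<Union>C" "infsum c C \<le> net_content A + ennreal (e/2)"
      using near_optimal_cover[OF conjunct1[OF True] half_gt_zero[OF \<open>0 < e\<close>]] by blast
    obtain C' where C': "C' \<subseteq> T" "B \<subseteq> \<Union>C'" "infsum c C' \<le> net_content B + ennreal (e/2)"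
      using near_optimal_cover[OF conjunct2[OF True] half_gt_zero[OF \<open>0 < e\<close>]] by blast
    have "net_content (A \<union> B) \<le> infsum c (maximal (C \<union> C'))"
      using C C' Union_maximal[of "C \<union> C'"] maximal_subset[of "C \<union> C'"]
      by (intro content_le) auto
    moreover have "net_content (A \<inter> B) \<le> net_content (\<Union>C \<inter> \<Union>C')"
      using C C' by (intro content_mono) auto
    ultimately have "net_content (A \<union> B) + net_content (A \<inter> B) \<le> infsum c C + infsum c C'"
      using cost_maximal_Un[OF C(1) C'(1)] by (meson add_mono order_trans)
    also have "\<dots> \<le> (net_content A + ennreal (e/2)) + (net_content B + ennreal (e/2))"
      using C C' by (intro add_mono) auto
    also have "\<dots> = net_content A + net_content B + (ennreal (e/2) + ennreal (e/2))"
      by (simp only: add_ac)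
    also have "ennreal (e/2) + ennreal (e/2) = ennreal e"
      using \<open>0 < e\<close> by (simp flip: ennreal_plus)
    finally show "net_content (A \<union> B) + net_content (A \<inter> B) \<le> net_content A + net_content B + ennreal e" .
  qed
next
  case False
  then show ?thesis by (auto simp: not_less top_unique)
qed

text \<open>The increasing sets lemma. Contents are not measures, so continuity from below needs an argument.
Take covers \<open>C k\<close> of \<open>A k\<close> that are optimal up to \<open>e / 2 ^ Suc k\<close> and merge them one after the
other. When \<open>C (Suc k)\<close> is merged into the cover obtained from \<open>C 0, \<dots>, C k\<close>, both cover
\<open>A k\<close>, so by \<open>cost_maximal_Un\<close> at least the content of \<open>A k\<close> is saved, and only the errors
accumulate. The maximal members of all the covers together then cover the union.\<close>
lemma content_incseq_Union_le:
  assumes "incseq A"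
  shows "net_content (\<Union>k. A k) \<le> (SUP k. net_content (A k))"
proof (cases "(SUP k. net_content (A k)) < \<infinity>")
  case False
  then have "(SUP k. net_content (A k)) = top"
    by (metis infinity_ennreal_def top.not_eq_extremum)
  then show ?thesis by (simp only: top_greatest)
next
  case True
  let ?L = "SUP k. net_content (A k)"
  have L: "net_content (A k) \<le> ?L" for k by (rule SUP_upper) simp
  have fin: "net_content (A k) < \<infinity>" for k
    using L True by (rule le_less_trans)
  show ?thesis
  proof (rule ennreal_le_epsilon)
    fix e :: real assume e: "0 < e"
    define d where "d k = e * (1/2) ^ Suc k" for k
    have d: "0 < d k" for k using e by (simp add: d_def)
    have sum_d: "(\<Sum>j\<le>k. d j) = e * (1 - (1/2) ^ Suc k)" for k
      by (induction k) (auto simp: d_def field_simps)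
    have "\<exists>C. C \<subseteq> T \<and> A k \<subseteq> \<Union>C \<and> infsum c C \<le> net_content (A k) + ennreal (d k)" for k
      using near_optimal_cover[OF fin d] .
    then obtain C where "\<forall>k. C k \<subseteq> T \<and> A k \<subseteq> \<Union>(C k)
        \<and> infsum c (C k) \<le> net_content (A k) + ennreal (d k)"
      using choice[of "\<lambda>k C. C \<subseteq> T \<and> A k \<subseteq> \<Union>C \<and> infsum c C \<le> net_content (A k) + ennreal (d k)"]
      by blast
    then have C: "C k \<subseteq> T" "A k \<subseteq> \<Union>(C k)"
      "infsum c (C k) \<le> net_content (A k) + ennreal (d k)" for k by simp_all
    define H where "H k = (\<Union>j\<le>k. C j)" for k
    have HT: "H k \<subseteq> T" for k using C(1) by (auto simp: H_def)
    have inc: "incseq H" unfolding H_def by (intro monoI UN_mono) auto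
    have AH: "A k \<subseteq> \<Union>(H k)" for k using C(2)[of k] unfolding H_def by blast
    have H_Suc: "H (Suc k) = H k \<union> C (Suc k)" for k
      unfolding H_def by (simp only: atMost_Suc UN_insert Un_commute)
    \<comment> \<open>Merging the first covers costs no more than an optimal cover of the last set, up to the
      accumulated errors.\<close>
    have bound: "infsum c (maximal (H k)) \<le> net_content (A k) + ennreal (\<Sum>j\<le>k. d j)" for k
    proof (induction k)
      case 0
      have "infsum c (maximal (C 0)) \<le> infsum c (C 0)"
        by (intro infsum_mono_subset_ennreal maximal_subset)
      then show ?case using C(3)[of 0] by (simp add: H_def)
    next
      case (Suc k)
      have max: "maximal (H (Suc k)) = maximal (maximal (H k) \<union> C (Suc k))"
        using maximal_absorb[OF HT[of k] C(1)[of "Suc k"]] H_Suc[of k] by simp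
      have "A k \<subseteq> A (Suc k)" using assms by (simp add: incseq_SucD)
      then have "net_content (A k) \<le> net_content (\<Union>(maximal (H k)) \<inter> \<Union>(C (Suc k)))"
        using AH[of k] C(2)[of "Suc k"] Union_maximal[OF HT[of k]] by (intro content_mono) auto
      then have "infsum c (maximal (H (Suc k))) + net_content (A k)
          \<le> infsum c (maximal (H (Suc k))) + net_content (\<Union>(maximal (H k)) \<inter> \<Union>(C (Suc k)))"
        by (rule add_left_mono)
      also have "\<dots> \<le> infsum c (maximal (H k)) + infsum c (C (Suc k))"
        unfolding max using maximal_subset HT C(1) by (intro cost_maximal_Un) blast+
      also have "\<dots> \<le> (net_content (A k) + ennreal (\<Sum>j\<le>k. d j))
          + (net_content (A (Suc k)) + ennreal (d (Suc k)))"
        using Suc C(3) by (rule add_mono)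
      also have "\<dots> = (net_content (A (Suc k))
          + (ennreal (\<Sum>j\<le>k. d j) + ennreal (d (Suc k)))) + net_content (A k)"
        by (simp only: add_ac)
      also have "ennreal (\<Sum>j\<le>k. d j) + ennreal (d (Suc k)) = ennreal (\<Sum>j\<le>Suc k. d j)"
        using ennreal_plus[OF sum_nonneg[of "{..k}" d] less_imp_le[OF d[of "Suc k"]]]
          d[THEN less_imp_le] by simp
      finally show ?case using fin[of k] by (auto simp: less_top)
    qed
    define Z where "Z = maximal (\<Union>k. H k)"
    have UT: "(\<Union>k. H k) \<subseteq> T" using HT by auto
    have "infsum c Z \<le> ?L + ennreal e"
    proof (rule infsum_le_incseq_ennreal[OF inc])
      show "Z \<subseteq> (\<Union>k. H k)" unfolding Z_def by (rule maximal_subset)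
      fix k
      \<comment> \<open>A member that is maximal among all the covers is maximal among the first ones as soon as it
        occurs there.\<close>
      have "Z \<inter> H k \<subseteq> maximal (H k)" by (auto simp: Z_def maximal_def)
      then have "infsum c (Z \<inter> H k) \<le> net_content (A k) + ennreal (\<Sum>j\<le>k. d j)"
        by (rule order_trans[OF infsum_mono_subset_ennreal bound])
      also have "\<dots> \<le> ?L + ennreal e"
        unfolding sum_d using e by (intro add_mono L ennreal_leI) simp
      finally show "infsum c (Z \<inter> H k) \<le> ?L + ennreal e" .
    qed
    moreover have "net_content (\<Union>k. A k) \<le> infsum c Z"
    proof (rule content_le)
      show "Z \<subseteq> T" using UT maximal_subset unfolding Z_def by blast
      show "(\<Union>k. A k) \<subseteq> \<Union>Z" using AH unfolding Z_def Union_maximal[OF UT] by blast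
    qed
    ultimately show "net_content (\<Union>k. A k) \<le> ?L + ennreal e" by (rule order_trans[rotated])
  qed
qed

text \<open>If \<open>S\<close> has full content in \<open>Q\<close>, then replacing \<open>Q\<close> by \<open>S \<inter> Q\<close> inside a larger set does not lower
the content: this is strong subadditivity for \<open>B \<union> (S \<inter> Q)\<close> and \<open>Q\<close>, whose intersection contains
\<open>S \<inter> Q\<close>, after cancelling the finite content of \<open>Q\<close>.\<close>
lemma content_Un_trace:
  assumes "Q \<in> T" "net_content Q \<le> net_content (S \<inter> Q)"
  shows "net_content (B \<union> Q) \<le> net_content (B \<union> (S \<inter> Q))"
proof -
  let ?X = "B \<union> (S \<inter> Q)"
  have "net_content (B \<union> Q) + net_content Q \<le> net_content (?X \<union> Q) + net_content (?X \<inter> Q)"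
    using assms(2) by (intro add_mono content_mono order_trans[OF assms(2)]) auto
  also have "\<dots> \<le> net_content ?X + net_content Q" by (rule content_strongly_subadditive)
  finally show ?thesis using content_net_finite[OF assms(1)] by (auto simp: less_top)
qed

lemma content_trace_finite_Union:
  assumes "finite \<Q>" "\<Q> \<subseteq> T" "\<And>Q. Q \<in> T \<Longrightarrow> net_content Q \<le> net_content (S \<inter> Q)"
  shows "net_content (B \<union> \<Union>\<Q>) \<le> net_content (B \<union> (S \<inter> \<Union>\<Q>))"
  using assms(1,2)
proof (induction \<Q> arbitrary: B)
  case empty
  then show ?case by simp
next
  case (insert Q \<Q>)
  have "net_content (B \<union> \<Union>(insert Q \<Q>)) = net_content ((B \<union> Q) \<union> \<Union>\<Q>)" by (simp add: Un_assoc)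
  also have "\<dots> \<le> net_content ((B \<union> Q) \<union> (S \<inter> \<Union>\<Q>))" using insert by auto
  also have "\<dots> = net_content ((B \<union> (S \<inter> \<Union>\<Q>)) \<union> Q)" by (simp add: Un_ac)
  also have "\<dots> \<le> net_content ((B \<union> (S \<inter> \<Union>\<Q>)) \<union> (S \<inter> Q))"
    using insert assms(3) by (intro content_Un_trace) auto
  also have "\<dots> = net_content (B \<union> (S \<inter> \<Union>(insert Q \<Q>)))"
    by (rule arg_cong[of _ _ net_content]) auto
  finally show ?case .
qed

text \<open>The form in which the increasing sets lemma is used: a countable union of members is almost
exhausted, in content, by finitely many of them.\<close>
lemma content_Union_approx:
  assumes "countable \<Q>" "\<Q> \<subseteq> T" "t < net_content (\<Union>\<Q>)"
  obtains \<F> where "finite \<F>" "\<F> \<subseteq> \<Q>" "t < net_content (\<Union>\<F>)"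
proof -
  obtain F where F: "incseq F" "\<And>n. finite (F n)" "(\<Union>n. F n) = \<Q>"
    using countable_exhaustion[OF assms(1)] by blast
  have "(\<Union>n. \<Union>(F n)) = \<Union>\<Q>" using F(3) by auto
  moreover have "incseq (\<lambda>n. \<Union>(F n))"
    using F(1) by (intro monoI Union_mono) (auto dest: monoD)
  ultimately have "t < (SUP n. net_content (\<Union>(F n)))"
    using content_incseq_Union_le[of "\<lambda>n. \<Union>(F n)"] assms(3) by auto
  then obtain n where "t < net_content (\<Union>(F n))" by (auto simp: less_SUP_iff)
  then show ?thesis using that[of "F n"] F by auto
qed

text \<open>Full content in each single member propagates to countable unions of members, in particular to
open sets: for finite unions the members are replaced one by one, and the increasing sets lemma
does the rest.\<close>
lemma content_trace_Union:
  assumes "countable \<Q>" "\<Q> \<subseteq> T" "\<And>Q. Q \<in> T \<Longrightarrow> net_content Q \<le> net_content (S \<inter> Q)"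
  shows "net_content (\<Union>\<Q>) \<le> net_content (S \<inter> \<Union>\<Q>)"
proof (rule ccontr)
  assume "\<not> ?thesis"
  then obtain \<F> where F: "finite \<F>" "\<F> \<subseteq> \<Q>" "net_content (S \<inter> \<Union>\<Q>) < net_content (\<Union>\<F>)"
    using content_Union_approx[OF assms(1,2)] by (metis not_le)
  have "net_content (\<Union>\<F>) \<le> net_content (S \<inter> \<Union>\<F>)"
    using content_trace_finite_Union[of \<F> S "{}"] F assms by auto
  also have "\<dots> \<le> net_content (S \<inter> \<Union>\<Q>)" using F by (intro content_mono) auto
  finally show False using F by simp
qed

end

section \<open>Subadditivity of powers of a measure\<close>

lemma ennreal_powr_finite: "a < \<infinity> \<Longrightarrow> ennreal_powr a t < \<infinity>"
  by (auto simp: ennreal_powr_def)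

lemma ennreal_powr_mono:
  assumes "a \<le> b" "0 < t"
  shows "ennreal_powr a t \<le> ennreal_powr b t"
proof (cases "b = \<infinity>")
  case False
  then have "a \<noteq> \<infinity>" using assms(1) by (auto simp: top_unique)
  have "enn2real a \<le> enn2real b"
    using assms(1) False by (intro enn2real_mono) (auto simp: top.not_eq_extremum)
  then have "enn2real a powr t \<le> enn2real b powr t"
    using assms(2) by (intro powr_mono2) auto
  then show ?thesis
    using False \<open>a \<noteq> \<infinity>\<close> by (simp add: ennreal_powr_def ennreal_leI)
qed (simp add: ennreal_powr_def)

text \<open>Countable subadditivity of \<open>x \<mapsto> x powr t\<close> for \<open>t \<le> 1\<close>. If no term reaches \<open>s = y\<close>, then
\<open>x = x powr (1 - t) * x powr t \<le> y powr (1 - t) * x powr t\<close> for each term \<open>x\<close>, and summation gives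
\<open>y \<le> y powr (1 - t) * (\<Sum>x. x powr t)\<close>.\<close>
lemma ennreal_powr_le_infsum:
  fixes f :: "'b \<Rightarrow> ennreal"
  assumes "s \<le> infsum f C" "s < \<infinity>" "0 < t" "t \<le> 1"
  shows "ennreal_powr s t \<le> infsum (\<lambda>x. ennreal_powr (f x) t) C"
proof (cases "s = 0")
  case True
  then show ?thesis using assms by (simp add: ennreal_powr_def)
next
  case False
  let ?g = "\<lambda>x. ennreal_powr (f x) t"
  obtain y where y: "s = ennreal y" "0 < y"
    using assms(2) False by (cases s) (auto simp: less_le)
  define k where "k = y powr (1 - t)"
  have k: "0 < k" using y by (simp add: k_def)
  have split: "x = x powr (1 - t) * x powr t" if "0 \<le> x" for x :: real
    using that powr_add[of x "1 - t" t] by (cases "x = 0") auto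
  show ?thesis
  proof (cases "\<exists>x\<in>C. s \<le> f x")
    case True
    then obtain x where "x \<in> C" "s \<le> f x" by blast
    then have "ennreal_powr s t \<le> ?g x" using assms(3) by (intro ennreal_powr_mono)
    also have "\<dots> \<le> infsum ?g C" using \<open>x \<in> C\<close> by (rule infsum_member_le_ennreal)
    finally show ?thesis .
  next
    case False
    have chord: "f x \<le> ennreal k * ?g x" if "x \<in> C" for x
    proof -
      have "f x < ennreal y" using False that y by auto
      then obtain z where z: "f x = ennreal z" "0 \<le> z" "z \<le> y"
        by (cases "f x") (auto simp: ennreal_less_iff)
      have "z = z powr (1 - t) * z powr t" using z by (intro split)
      also have "\<dots> \<le> k * z powr t"
        unfolding k_def using z assms(4) by (intro mult_right_mono powr_mono2) auto
      finally show ?thesis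
        using z k by (simp add: ennreal_powr_def ennreal_leI flip: ennreal_mult)
    qed
    have "infsum f C \<le> ennreal k * infsum ?g C"
    proof (rule infsum_le_finite_sums)
      show "f summable_on C" by (auto intro: nonneg_summable_on_complete)
      fix F assume F: "finite F" "F \<subseteq> C"
      have "sum f F \<le> (\<Sum>x\<in>F. ennreal k * ?g x)"
        using F chord by (intro sum_mono) auto
      also have "\<dots> = ennreal k * sum ?g F" by (simp add: sum_distrib_left)
      also have "\<dots> \<le> ennreal k * infsum ?g C"
        using infsum_mono_subset_ennreal[OF F(2), of ?g] F(1) by (intro mult_left_mono) auto
      finally show "sum f F \<le> ennreal k * infsum ?g C" .
    qed
    moreover have "s = ennreal k * ennreal_powr s t"
      using split[of y] y k by (simp add: ennreal_powr_def k_def flip: ennreal_mult)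
    ultimately have "ennreal k * ennreal_powr s t \<le> ennreal k * infsum ?g C"
      using assms(1) by simp
    then show ?thesis
      using k by (simp add: ennreal_mult_le_mult_iff)
  qed
qed

section \<open>Dyadic cubes\<close>

text \<open>The cubes of one level are the fibres of a floor map. In this form it is visible that they
partition the space and that each level refines the coarser ones.\<close>
lemma dyadic_cube_eq_floor:
  "dyadic_cube P n m = {x. \<forall>i. \<lfloor>(x $ i - P $ i) * 2 powi n\<rfloor> = m $ i}"
proof -
  have "P $ i + of_int (m $ i) * 2 powi (- n) \<le> x $ i
      \<and> x $ i < P $ i + (of_int (m $ i) + 1) * 2 powi (- n)
      \<longleftrightarrow> \<lfloor>(x $ i - P $ i) * 2 powi n\<rfloor> = m $ i" for x i
  proof -
    have pos: "(0::real) < 2 powi n" by simp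
    have "\<lfloor>(x $ i - P $ i) * 2 powi n\<rfloor> = m $ i
      \<longleftrightarrow> of_int (m $ i) \<le> (x $ i - P $ i) * 2 powi n
        \<and> (x $ i - P $ i) * 2 powi n < of_int (m $ i) + 1"
      by (simp add: floor_eq_iff)
    also have "of_int (m $ i) \<le> (x $ i - P $ i) * 2 powi n
        \<longleftrightarrow> of_int (m $ i) / 2 powi n \<le> x $ i - P $ i"
      by (rule pos_divide_le_eq[OF pos, symmetric])
    also have "(x $ i - P $ i) * 2 powi n < of_int (m $ i) + 1
        \<longleftrightarrow> x $ i - P $ i < (of_int (m $ i) + 1) / 2 powi n"
      by (rule pos_less_divide_eq[OF pos, symmetric])
    finally show ?thesis
      by (simp add: power_int_minus divide_inverse algebra_simps)
  qed
  then show ?thesis unfolding dyadic_cube_def by blast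
qed

lemma floor_scale_coarsen:
  fixes y z :: real
  assumes "n \<le> n'" "\<lfloor>y * 2 powi n'\<rfloor> = \<lfloor>z * 2 powi n'\<rfloor>"
  shows "\<lfloor>y * 2 powi n\<rfloor> = \<lfloor>z * 2 powi n\<rfloor>"
proof -
  define k where "k = nat (n' - n)"
  have "n' = n + int k" using assms(1) by (simp add: k_def)
  then have "w * 2 powi n = (w * 2 powi n') / real_of_int (2 ^ k)" for w :: real
    by (simp add: power_int_add)
  then have "\<lfloor>w * 2 powi n\<rfloor> = \<lfloor>w * 2 powi n'\<rfloor> div 2 ^ k" for w :: real
    using floor_divide_real_eq_div[of "2 ^ k" "w * 2 powi n'"] by simp
  then show ?thesis using assms(2) by simp
qed

lemma dyadic_cube_nonempty: "dyadic_cube P n m \<noteq> {}"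
proof -
  have "(\<chi> i. P $ i + of_int (m $ i) * 2 powi (- n)) \<in> dyadic_cube P n m"
    by (simp add: dyadic_cube_def algebra_simps)
  then show ?thesis by blast
qed

lemma dyadic_cube_through:
  assumes "x \<in> dyadic_cube P n m"
  shows "dyadic_cube P n m = dyadic_cube P n (\<chi> i. \<lfloor>(x $ i - P $ i) * 2 powi n\<rfloor>)"
  using assms by (simp add: dyadic_cube_eq_floor)

lemma mem_dyadic_cube_through:
  "x \<in> dyadic_cube P n (\<chi> i. \<lfloor>(x $ i - P $ i) * 2 powi n\<rfloor>)"
  by (simp add: dyadic_cube_eq_floor)

lemma dyadic_cube_nested:
  assumes "n \<le> n'" "dyadic_cube P n m \<inter> dyadic_cube P n' m' \<noteq> {}"
  shows "dyadic_cube P n' m' \<subseteq> dyadic_cube P n m"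
proof
  fix y assume y: "y \<in> dyadic_cube P n' m'"
  obtain x where "x \<in> dyadic_cube P n m" "x \<in> dyadic_cube P n' m'" using assms(2) by blast
  then show "y \<in> dyadic_cube P n m"
    using y floor_scale_coarsen[OF assms(1)] unfolding dyadic_cube_eq_floor mem_Collect_eq
    by metis
qed

text \<open>A larger cube has a coarser level. Otherwise its side would be shorter, and the smaller cube
would contain its own lower corner \<open>a\<close> together with the point \<open>b\<close> that is one such side away
from \<open>a\<close> in every coordinate; a half-open cube of that side does not contain both.\<close>
lemma dyadic_cube_subset_level:
  assumes "dyadic_cube P n m \<subseteq> dyadic_cube P n' m'"
  shows "n' \<le> n"
proof (rule ccontr)
  assume "\<not> n' \<le> n"
  define a where "a = (\<chi> i. P $ i + of_int (m $ i) * 2 powi (- n))"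
  define b where "b = (\<chi> i. P $ i + of_int (m $ i) * 2 powi (- n) + 2 powi (- n'))"
  have "(2::real) powi (- n') < 2 powi (- n)"
    using \<open>\<not> n' \<le> n\<close> by (intro power_int_strict_increasing) auto
  then have "a \<in> dyadic_cube P n m" "b \<in> dyadic_cube P n m"
    by (simp_all add: dyadic_cube_def a_def b_def algebra_simps)
  then have "a \<in> dyadic_cube P n' m'" "b \<in> dyadic_cube P n' m'" using assms by auto
  then have "P $ i + of_int (m' $ i) * 2 powi (- n') \<le> a $ i"
    "b $ i < P $ i + of_int (m' $ i) * 2 powi (- n') + 2 powi (- n')" for i
    by (auto simp: dyadic_cube_def algebra_simps)
  moreover have "b $ i = a $ i + 2 powi (- n')" for i by (simp add: a_def b_def)
  ultimately show False by (metis add_le_cancel_right not_less)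
qed

lemma dyadic_cubes_iff: "Q \<in> dyadic_cubes P \<longleftrightarrow> (\<exists>n m. Q = dyadic_cube P n m)"
  by (auto simp: dyadic_cubes_def dyadic_cubes_level_def)

lemma dyadic_cubes_laminar:
  assumes "Q \<in> dyadic_cubes P" "Q' \<in> dyadic_cubes P" "Q \<inter> Q' \<noteq> {}"
  shows "Q \<subseteq> Q' \<or> Q' \<subseteq> Q"
proof -
  obtain n m n' m' where Q: "Q = dyadic_cube P n m" "Q' = dyadic_cube P n' m'"
    using assms by (auto simp: dyadic_cubes_iff)
  consider "n \<le> n'" | "n' \<le> n" by linarith
  then show ?thesis
    using assms(3) dyadic_cube_nested[of n n' P m m'] dyadic_cube_nested[of n' n P m' m] unfolding Q
    by cases (auto simp: Int_commute)
qed

text \<open>There is one cube of each level through a given point, and the level of a cube between \<open>Q\<close> and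
\<open>D\<close> is between the levels of these two.\<close>
lemma finite_dyadic_cubes_between:
  assumes "Q \<in> dyadic_cubes P" "D \<in> dyadic_cubes P"
  shows "finite {Q' \<in> dyadic_cubes P. Q \<subseteq> Q' \<and> Q' \<subseteq> D}"
proof -
  obtain n m k l where Q: "Q = dyadic_cube P n m" and D: "D = dyadic_cube P k l"
    using assms by (auto simp: dyadic_cubes_iff)
  obtain x where "x \<in> Q" using dyadic_cube_nonempty Q by blast
  let ?q = "\<lambda>j. dyadic_cube P j (\<chi> i. \<lfloor>(x $ i - P $ i) * 2 powi j\<rfloor>)"
  have "{Q' \<in> dyadic_cubes P. Q \<subseteq> Q' \<and> Q' \<subseteq> D} \<subseteq> ?q ` {k..n}"
  proof clarify
    fix Q' assume "Q' \<in> dyadic_cubes P" and sub: "Q \<subseteq> Q'" "Q' \<subseteq> D"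
    then obtain j m' where Q': "Q' = dyadic_cube P j m'" by (auto simp: dyadic_cubes_iff)
    have "j \<in> {k..n}" using sub dyadic_cube_subset_level unfolding Q D Q' by auto
    moreover have "Q' = ?q j" using dyadic_cube_through[of x P j m'] \<open>x \<in> Q\<close> sub Q' by auto
    ultimately show "Q' \<in> ?q ` {k..n}" by blast
  qed
  then show ?thesis by (rule finite_subset) simp
qed

lemma countable_dyadic_cubes: "countable (dyadic_cubes P)"
  unfolding dyadic_cubes_def dyadic_cubes_level_def by simp

text \<open>The crude bound of the Euclidean norm by the \<open>\<ell>\<^sub>1\<close> norm suffices to make cubes of high level small.\<close>
lemma dyadic_cube_subset_cball:
  fixes P :: "real ^ 'd"
  assumes "x \<in> dyadic_cube P n m"
  shows "dyadic_cube P n m \<subseteq> cball x (of_nat CARD('d) * 2 powi (- n))"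
proof
  fix y assume y: "y \<in> dyadic_cube P n m"
  have "\<bar>(x - y) $ i\<bar> \<le> 2 powi (- n)" for i
  proof -
    have "P $ i + of_int (m $ i) * 2 powi (- n) \<le> x $ i
        \<and> x $ i < P $ i + of_int (m $ i) * 2 powi (- n) + 2 powi (- n)"
      using assms by (simp add: dyadic_cube_def distrib_right add_ac)
    moreover have "P $ i + of_int (m $ i) * 2 powi (- n) \<le> y $ i
        \<and> y $ i < P $ i + of_int (m $ i) * 2 powi (- n) + 2 powi (- n)"
      using y by (simp add: dyadic_cube_def distrib_right add_ac)
    ultimately show ?thesis by (simp add: abs_le_iff)
  qed
  then have "(\<Sum>i\<in>UNIV. \<bar>(x - y) $ i\<bar>) \<le> of_nat CARD('d) * 2 powi (- n)"
    by (intro sum_bounded_above) auto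
  then show "y \<in> cball x (of_nat CARD('d) * 2 powi (- n))"
    using norm_le_l1_cart[of "x - y"] by (simp add: dist_norm)
qed

lemma bounded_dyadic_cube: "Q \<in> dyadic_cubes P \<Longrightarrow> bounded Q"
  using dyadic_cube_subset_cball dyadic_cube_nonempty
  unfolding dyadic_cubes_iff by (metis bounded_cball bounded_subset ex_in_conv)

lemma dyadic_cube_borel: "Q \<in> dyadic_cubes P \<Longrightarrow> Q \<in> sets borel"
proof -
  assume "Q \<in> dyadic_cubes P"
  then obtain n m where "Q = dyadic_cube P n m" by (auto simp: dyadic_cubes_iff)
  then have "Q = (\<Inter>i. {x. P $ i + of_int (m $ i) * 2 powi (- n) \<le> x $ i}
      \<inter> {x. x $ i < P $ i + (of_int (m $ i) + 1) * 2 powi (- n)})"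
    by (auto simp: dyadic_cube_def)
  also have "\<dots> \<in> sets borel"
    by (intro sets.finite_INT sets.Int borel_closed borel_open closed_Collect_le open_Collect_less
        continuous_intros) auto
  finally show ?thesis .
qed

lemma open_eq_Union_dyadic_cubes:
  fixes P :: "real ^ 'd"
  assumes "open V"
  shows "\<Union>{Q \<in> dyadic_cubes P. closure Q \<subseteq> V} = V"
proof
  show "\<Union>{Q \<in> dyadic_cubes P. closure Q \<subseteq> V} \<subseteq> V"
    using closure_subset by blast
  show "V \<subseteq> \<Union>{Q \<in> dyadic_cubes P. closure Q \<subseteq> V}"
  proof
    fix x assume "x \<in> V"
    then obtain e where e: "0 < e" "cball x e \<subseteq> V" using assms open_contains_cball by blast
    have "0 < e / of_nat CARD('d)" using e by simp
    then obtain k :: nat where "(1/2::real) ^ k < e / of_nat CARD('d)"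
      using real_arch_pow_inv[of "e / of_nat CARD('d)" "1/2"] by auto
    then have k: "of_nat CARD('d) * 2 powi (- int k) \<le> e"
      by (simp add: power_int_minus field_simps)
    let ?Q = "dyadic_cube P (int k) (\<chi> i. \<lfloor>(x $ i - P $ i) * 2 powi (int k)\<rfloor>)"
    have "x \<in> ?Q" by (rule mem_dyadic_cube_through)
    have "?Q \<subseteq> cball x e"
      using dyadic_cube_subset_cball[OF \<open>x \<in> ?Q\<close>] subset_cball[OF k, of x] by (rule order_trans)
    then have "closure ?Q \<subseteq> V" using e(2) closure_minimal[of ?Q "cball x e"] by auto
    then show "x \<in> \<Union>{Q \<in> dyadic_cubes P. closure Q \<subseteq> V}"
      using \<open>x \<in> ?Q\<close> by (auto simp: dyadic_cubes_iff)
  qed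
qed

lemma dyadic_boundary_eq: "dyadic_boundary P = (\<Union>Q\<in>dyadic_cubes P. frontier Q)"
  by (auto simp: dyadic_boundary_def dyadic_cubes_def)

lemma dyadic_boundary_borel: "dyadic_boundary P \<in> sets borel"
  unfolding dyadic_boundary_eq
  by (intro sets.countable_UN'' countable_dyadic_cubes borel_closed frontier_closed)

lemma locally_finite_measure_bounded:
  fixes M :: "'a::heine_borel measure"
  assumes "locally_finite_measure M" "sets M = sets borel" "bounded B"
  shows "emeasure M B < \<infinity>"
proof -
  have "compact (closure B)" using assms(3) by (simp add: compact_closure)
  moreover have "\<exists>U. open U \<and> x \<in> U \<and> emeasure M U < \<infinity>" for x
    using assms(1) by (simp add: locally_finite_measure_def)
  then obtain U where U: "\<And>x. open (U x)" "\<And>x. x \<in> U x" "\<And>x. emeasure M (U x) < \<infinity>" by metis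
  moreover have "closure B \<subseteq> (\<Union>x\<in>closure B. U x)" using U(2) by blast
  ultimately obtain F where F: "finite F" "closure B \<subseteq> (\<Union>x\<in>F. U x)"
    by (metis compactE_image)
  have "emeasure M B \<le> emeasure M (\<Union>x\<in>F. U x)"
    using F closure_subset[of B] U(1) assms(2) by (intro emeasure_mono) (auto intro!: sets.finite_UN)
  also have "\<dots> \<le> (\<Sum>x\<in>F. emeasure M (U x))"
    using F(1) U(1) assms(2) by (intro emeasure_subadditive_finite) auto
  also have "\<dots> < \<infinity>" using U(3) F(1) by simp
  finally show ?thesis .
qed

section \<open>Sequences of \<open>G\<^sub>\<delta>\<close> sets\<close>

lemma gdelta_sequence_open:
  assumes "\<And>n::nat. gdelta (E n)"
  shows "\<exists>U. (\<forall>n k::nat. open (U n k)) \<and> (\<forall>n. E n = (\<Inter>k. U n k))"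
proof -
  have "\<exists>U. (\<forall>k::nat. open (U k)) \<and> E n = (\<Inter>k. U k)" for n
    using assms[of n] by cases blast
  then show ?thesis by metis
qed

lemma gdelta_INT:
  assumes "\<And>n::nat. gdelta (E n)"
  shows "gdelta (\<Inter>n. E n)"
proof -
  obtain U where U: "\<And>n k::nat. open (U n k)" "\<And>n. E n = (\<Inter>k. U n k)"
    using gdelta_sequence_open[of E, OF assms] by blast
  have "gdelta (\<Inter>n. case prod_decode n of (m, k) \<Rightarrow> U m k)"
    by (rule gdelta.intros) (simp add: U(1) split: prod.split)
  also have "(\<Inter>n. case prod_decode n of (m, k) \<Rightarrow> U m k) = (\<Inter>n. E n)"
    unfolding U(2) by (auto split: prod.splits) (metis prod_encode_inverse)
  finally show ?thesis .
qed

section \<open>Dyadic contents inside a fixed cube\<close>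

text \<open>The cube \<open>D\<close> is the one in which the contents of the large intersection class are to be compared.\<close>
locale dyadic_measure =
  fixes P :: "real ^ 'd" and \<mu> :: "(real ^ 'd) measure" and \<eta> :: real and D :: "(real ^ 'd) set"
  assumes sets_borel: "sets \<mu> = sets borel"
    and locally_finite: "locally_finite_measure \<mu>"
    and boundary_null: "emeasure \<mu> (dyadic_boundary P) = 0"
    and exponent_pos: "0 < \<eta>" and exponent_le_1: "\<eta> \<le> 1"
    and D_cube: "D \<in> dyadic_cubes P"
begin

definition subcubes :: "(real ^ 'd) set set" where
  "subcubes = {Q \<in> dyadic_cubes P. Q \<subseteq> D}"

definition cost :: "(real ^ 'd) set \<Rightarrow> ennreal" where
  "cost Q = ennreal_powr (emeasure \<mu> Q) \<eta>"

lemma emeasure_cube_finite: "Q \<in> dyadic_cubes P \<Longrightarrow> emeasure \<mu> Q < \<infinity>"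
  by (intro locally_finite_measure_bounded locally_finite sets_borel bounded_dyadic_cube)

sublocale net subcubes cost
proof
  show "Q \<subseteq> Q' \<or> Q' \<subseteq> Q" if "Q \<in> subcubes" "Q' \<in> subcubes" "Q \<inter> Q' \<noteq> {}" for Q Q'
    using that dyadic_cubes_laminar[of Q P Q'] by (simp add: subcubes_def)
  show "finite {Q' \<in> subcubes. Q \<subseteq> Q'}" if "Q \<in> subcubes" for Q
    by (rule finite_subset[OF _ finite_dyadic_cubes_between[of Q P D]])
      (use that D_cube in \<open>auto simp: subcubes_def\<close>)
  show "cost Q < \<infinity>" if "Q \<in> subcubes" for Q
    using that emeasure_cube_finite unfolding cost_def subcubes_def
    by (intro ennreal_powr_finite) simp
qed

lemma countable_subcubes: "countable subcubes"
  unfolding subcubes_def by (rule countable_subset[OF _ countable_dyadic_cubes[of P]]) auto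

lemma D_subcube: "D \<in> subcubes"
  using D_cube by (simp add: subcubes_def)

text \<open>A cube is its own cheapest cover, even when a null set need not be covered: covers of almost all
of \<open>Q\<close> have total measure at least that of \<open>Q\<close>, and powers with exponent at most one are
subadditive.\<close>
lemma cost_le_cover:
  assumes "Q \<in> dyadic_cubes P" "C \<subseteq> dyadic_cubes P" "Q - Z \<subseteq> \<Union>C"
    and "Z \<in> sets borel" "emeasure \<mu> Z = 0"
  shows "cost Q \<le> infsum cost C"
proof -
  have [measurable]: "Q \<in> sets \<mu>" "Z \<in> sets \<mu>"
    using assms dyadic_cube_borel sets_borel by auto
  have "emeasure \<mu> Q = emeasure \<mu> (Q - Z)"
    using assms(5) by (intro emeasure_Diff_null_set[symmetric]) auto
  also have "\<dots> \<le> infsum (emeasure \<mu>) C"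
    using assms(2,3) dyadic_cube_borel sets_borel
    by (intro emeasure_le_infsum_cover) (auto intro: countable_subset[OF _ countable_dyadic_cubes])
  finally show ?thesis
    using emeasure_cube_finite[OF assms(1)] exponent_pos exponent_le_1
    unfolding cost_def by (intro ennreal_powr_le_infsum)
qed

text \<open>For subsets of \<open>D\<close>, cubes outside \<open>D\<close> do not help: a cube of a cover that meets \<open>D\<close> is contained in
\<open>D\<close> or contains it, and in the second case the cover costs at least as much as \<open>D\<close> itself.\<close>
lemma dyadic_content_eq_net_content:
  assumes "A \<subseteq> D"
  shows "dyadic_content P \<mu> \<eta> A = net_content A"
proof (rule antisym)
  show "dyadic_content P \<mu> \<eta> A \<le> net_content A"
    unfolding dyadic_content_def net_content_def cost_def[symmetric]
    by (rule INF_superset_mono)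
      (auto simp: subcubes_def intro: countable_subset[OF _ countable_dyadic_cubes[of P]])
  show "net_content A \<le> dyadic_content P \<mu> \<eta> A"
    unfolding dyadic_content_def cost_def[symmetric]
  proof (rule INF_greatest)
    fix C assume "C \<in> {C. countable C \<and> C \<subseteq> dyadic_cubes P \<and> A \<subseteq> \<Union>C}"
    then have C: "C \<subseteq> dyadic_cubes P" "A \<subseteq> \<Union>C" by auto
    show "net_content A \<le> infsum cost C"
    proof (cases "\<exists>Q\<in>C. D \<subseteq> Q")
      case True
      then have "D - {} \<subseteq> \<Union>C" by auto
      then have "cost D \<le> infsum cost C"
        using C(1) D_cube by (intro cost_le_cover[where Z = "{}"]) auto
      moreover have "net_content A \<le> cost D"
        using content_le[of "{D}" A] D_subcube assms by simp
      ultimately show ?thesis by simp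
    next
      case False
      have "A \<subseteq> \<Union>(C \<inter> subcubes)"
      proof
        fix x assume "x \<in> A"
        then obtain Q where Q: "Q \<in> C" "x \<in> Q" using C(2) by auto
        then have "Q \<subseteq> D"
          using False dyadic_cubes_laminar[of Q P D] D_cube C(1) assms \<open>x \<in> A\<close> by blast
        then show "x \<in> \<Union>(C \<inter> subcubes)" using Q C(1) by (auto simp: subcubes_def)
      qed
      then have "net_content A \<le> infsum cost (C \<inter> subcubes)" by (intro content_le) auto
      also have "\<dots> \<le> infsum cost C" by (rule infsum_mono_subset_ennreal) simp
      finally show ?thesis .
    qed
  qed
qed

text \<open>Removing a null set from a cube does not change its content, although the content of the null
set itself may be positive.\<close>
lemma content_diff_null:
  assumes "Q \<in> subcubes" "Z \<in> sets borel" "emeasure \<mu> Z = 0"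
  shows "net_content Q \<le> net_content (- Z \<inter> Q)"
proof -
  have "net_content Q \<le> cost Q" using content_le[of "{Q}" Q] assms(1) by simp
  also have "\<dots> \<le> net_content (- Z \<inter> Q)"
    unfolding net_content_def
    by (intro INF_greatest cost_le_cover[of Q _ Z]) (use assms in \<open>auto simp: subcubes_def\<close>)
  finally show ?thesis .
qed

text \<open>As the boundaries of the cubes carry no measure, half-open cubes may be replaced by open ones.\<close>
lemma content_le_interior:
  assumes "\<Q> \<subseteq> subcubes"
  shows "net_content (\<Union>\<Q>) \<le> net_content (interior (\<Union>\<Q>))"
proof -
  have "countable \<Q>" using assms countable_subcubes by (rule countable_subset)
  then have "net_content (\<Union>\<Q>) \<le> net_content (- dyadic_boundary P \<inter> \<Union>\<Q>)"
    by (intro content_trace_Union assms content_diff_null dyadic_boundary_borel boundary_null)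
  also have "- dyadic_boundary P \<inter> \<Union>\<Q> \<subseteq> interior (\<Union>\<Q>)"
  proof clarify
    fix x Q assume x: "x \<notin> dyadic_boundary P" "x \<in> Q" "Q \<in> \<Q>"
    then have "x \<notin> frontier Q"
      using assms by (auto simp: dyadic_boundary_eq subcubes_def)
    then have "x \<in> interior Q"
      using x(2) closure_subset[of Q] by (auto simp: frontier_def)
    then show "x \<in> interior (\<Union>\<Q>)"
      using interior_mono[of Q "\<Union>\<Q>"] x(3) by blast
  qed
  then have "net_content (- dyadic_boundary P \<inter> \<Union>\<Q>) \<le> net_content (interior (\<Union>\<Q>))"
    by (rule content_mono)
  finally show ?thesis .
qed

lemma open_subset_eq_Union_subcubes:
  assumes "open V" "V \<subseteq> D"
  shows "\<Union>{Q \<in> subcubes. closure Q \<subseteq> V} = V"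
proof -
  have "{Q \<in> subcubes. closure Q \<subseteq> V} = {Q \<in> dyadic_cubes P. closure Q \<subseteq> V}"
    using assms(2) closure_subset by (auto simp: subcubes_def)
  then show ?thesis using open_eq_Union_dyadic_cubes[OF assms(1), of P] by simp
qed

text \<open>The step of the Cantor scheme. The part of \<open>V\<close> in \<open>G\<close> still has content above \<open>t\<close>; finitely many
cubes whose closures lie in \<open>V \<inter> G\<close> carry enough of it, and so does the interior of their union.\<close>
lemma shrink_open:
  assumes "open V" "V \<subseteq> D" "t < net_content V"
    and "open G" "\<And>Q. Q \<in> subcubes \<Longrightarrow> net_content Q \<le> net_content (G \<inter> Q)"
  shows "\<exists>W. open W \<and> closure W \<subseteq> V \<inter> G \<and> t < net_content W"
proof -
  let ?\<Q> = "\<lambda>V. {Q \<in> subcubes. closure Q \<subseteq> V}"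
  have countable: "countable (?\<Q> U)" for U
    by (rule countable_subset[OF _ countable_subcubes]) auto
  note V = open_subset_eq_Union_subcubes[OF assms(1,2)]
  have VG: "\<Union>(?\<Q> (V \<inter> G)) = V \<inter> G"
    by (rule open_subset_eq_Union_subcubes) (use assms in auto)
  have "net_content V \<le> net_content (G \<inter> V)"
    using content_trace_Union[OF countable _ assms(5), of V] unfolding V by auto
  then have "t < net_content (\<Union>(?\<Q> (V \<inter> G)))"
    using assms(3) unfolding VG by (simp add: Int_commute)
  then obtain \<F> where F: "finite \<F>" "\<F> \<subseteq> ?\<Q> (V \<inter> G)" "t < net_content (\<Union>\<F>)"
    using content_Union_approx[OF countable] by blast
  show ?thesis
  proof (intro exI conjI)
    show "open (interior (\<Union>\<F>))" by simp
    have "closure (interior (\<Union>\<F>)) \<subseteq> closure (\<Union>\<F>)" by (intro closure_mono interior_subset)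
    also have "\<dots> \<subseteq> (\<Union>Q\<in>\<F>. closure Q)"
      using F(1) closure_subset by (intro closure_minimal closed_UN) auto
    also have "\<dots> \<subseteq> V \<inter> G" using F(2) by blast
    finally show "closure (interior (\<Union>\<F>)) \<subseteq> V \<inter> G" .
    have "net_content (\<Union>\<F>) \<le> net_content (interior (\<Union>\<F>))"
      using F(2) by (intro content_le_interior) auto
    then show "t < net_content (interior (\<Union>\<F>))" using F(3) by simp
  qed
qed

text \<open>A Baire type argument. If some cover of the intersection were cheaper than \<open>D\<close>, at cost \<open>t\<close>,
then iterating \<open>shrink_open\<close> from the interior of \<open>D\<close> would give open sets \<open>V n\<close> of content above
\<open>t\<close> whose closures are nested and shrink to a compact subset of the intersection. As this
compact set avoids all boundaries of cubes, it is covered already by the interiors of the cubes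
of the cover, hence so is some \<open>closure (V n)\<close>, which contradicts the content of \<open>V n\<close>.\<close>
lemma content_INT_open:
  assumes "\<And>n::nat. open (G n)"
    and "\<And>n Q. Q \<in> subcubes \<Longrightarrow> net_content Q \<le> net_content (G n \<inter> Q)"
    and off_boundary: "(\<Inter>n. G n) \<inter> dyadic_boundary P = {}"
  shows "net_content D \<le> net_content ((\<Inter>n. G n) \<inter> D)"
proof (rule ccontr)
  assume "\<not> ?thesis"
  then obtain C where C: "C \<subseteq> subcubes" "(\<Inter>n. G n) \<inter> D \<subseteq> \<Union>C" "infsum cost C < net_content D"
    unfolding net_content_def[of "(\<Inter>n. G n) \<inter> D"] not_le INF_less_iff by auto
  define t where "t = infsum cost C"
  define good where "good V \<longleftrightarrow> open V \<and> V \<subseteq> D \<and> t < net_content V" for V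
  have "net_content D \<le> net_content (interior D)"
    using content_le_interior[of "{D}"] D_subcube by simp
  then have "good (interior D)"
    using C(3) by (auto simp: good_def t_def interior_subset[THEN subsetD])
  have step: "\<exists>W. good W \<and> closure W \<subseteq> V \<inter> G n" if "good V" for V n
  proof -
    have "\<exists>W. open W \<and> closure W \<subseteq> V \<inter> G n \<and> t < net_content W"
      using that by (intro shrink_open assms(1,2)) (auto simp: good_def)
    then obtain W where "open W" "closure W \<subseteq> V \<inter> G n" "t < net_content W" by blast
    moreover have "W \<subseteq> D"
      using that \<open>closure W \<subseteq> _\<close> closure_subset[of W] by (auto simp: good_def)
    ultimately show ?thesis by (auto simp: good_def)
  qed
  obtain V where V: "V 0 = interior D" "\<And>n. good (V n)" "\<And>n. closure (V (Suc n)) \<subseteq> V n \<inter> G n"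
  proof -
    have "\<exists>V. \<forall>n. (good (V n) \<and> (n = 0 \<longrightarrow> V n = interior D)) \<and> closure (V (Suc n)) \<subseteq> V n \<inter> G n"
      by (rule dependent_nat_choice) (use step \<open>good (interior D)\<close> in auto)
    then show ?thesis using that by blast
  qed
  have decseq: "V n \<subseteq> V m" if "m \<le> n" for m n
    using that by (rule lift_Suc_antimono_le[rotated]) (use V(3) closure_subset in blast)
  define U where "U = (\<Union>Q\<in>C. interior Q)"
  have "\<exists>n. closure (V n) \<subseteq> U"
  proof (rule ccontr)
    assume contra: "\<not> ?thesis"
    have "(\<Inter>n. closure (V n) - U) \<noteq> {}"
    proof (rule compact_nest)
      have "bounded (V n)" for n
        using V(2)[of n] bounded_dyadic_cube[OF D_cube] bounded_subset unfolding good_def by blast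
      moreover have "open U" unfolding U_def by blast
      ultimately show "compact (closure (V n) - U)" for n
        by (intro compact_diff) (auto simp: compact_closure)
      show "closure (V n) - U \<noteq> {}" for n using contra by blast
      show "closure (V n) - U \<subseteq> closure (V m) - U" if "m \<le> n" for m n
        using closure_mono[OF decseq[OF that]] by blast
    qed
    then obtain x where x: "\<And>n. x \<in> closure (V n)" "x \<notin> U" by blast
    have "x \<in> G n" "x \<in> V n" for n using x(1)[of "Suc n"] V(3)[of n] by auto
    then have xG: "x \<in> (\<Inter>n. G n) \<inter> D" using V(1) interior_subset by blast
    then obtain Q where Q: "Q \<in> C" "x \<in> Q" using C(2) by blast
    have "x \<notin> frontier Q"
      using xG off_boundary Q(1) C(1) by (auto simp: dyadic_boundary_eq subcubes_def)
    then have "x \<in> interior Q" using Q(2) closure_subset[of Q] by (auto simp: frontier_def)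
    then show False using x(2) Q(1) unfolding U_def by blast
  qed
  then obtain n where n: "closure (V n) \<subseteq> U" by blast
  have "V n \<subseteq> \<Union>C" using n closure_subset[of "V n"] interior_subset unfolding U_def by blast
  then have "net_content (V n) \<le> t" unfolding t_def using C(1) by (intro content_le)
  moreover have "t < net_content (V n)" using V(2) by (simp add: good_def)
  ultimately show False by simp
qed

text \<open>The open sets whose intersections are the sets \<open>E n\<close> are supplemented by the complements of the
frontiers of the cubes. These are open with full content by \<open>content_diff_null\<close>, and they make
the intersection avoid the dyadic boundary, as \<open>content_INT_open\<close> demands.\<close>
lemma content_INT_gdelta:
  assumes "\<And>n::nat. gdelta (E n)"
    and "\<And>n Q. Q \<in> subcubes \<Longrightarrow> net_content Q \<le> net_content (E n \<inter> Q)"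
  shows "net_content D \<le> net_content ((\<Inter>n. E n) \<inter> D)"
proof -
  obtain U where U: "\<And>n k::nat. open (U n k)" "\<And>n. E n = (\<Inter>k. U n k)"
    using gdelta_sequence_open[of E, OF assms(1)] by blast
  define \<G> where "\<G> = range (\<lambda>(n, k). U n k) \<union> (\<lambda>Q. - frontier Q) ` dyadic_cubes P"
  have "countable \<G>" unfolding \<G>_def using countable_dyadic_cubes by auto
  have "\<G> \<noteq> {}" by (auto simp: \<G>_def)
  note range = range_from_nat_into[OF \<open>\<G> \<noteq> {}\<close> \<open>countable \<G>\<close>]
  have INT: "(\<Inter>n. from_nat_into \<G> n) = (\<Inter>n. E n) - dyadic_boundary P"
    unfolding range by (auto simp: \<G>_def U(2) dyadic_boundary_eq)
  have "net_content D \<le> net_content ((\<Inter>n. from_nat_into \<G> n) \<inter> D)"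
  proof (rule content_INT_open)
    fix n
    have G: "from_nat_into \<G> n \<in> \<G>" using \<open>\<G> \<noteq> {}\<close> by (rule from_nat_into)
    then show "open (from_nat_into \<G> n)"
      unfolding \<G>_def using U(1) by (auto simp: open_Compl)
    fix Q assume Q: "Q \<in> subcubes"
    from G consider m k where "from_nat_into \<G> n = U m k"
      | R where "R \<in> dyadic_cubes P" "from_nat_into \<G> n = - frontier R"
      unfolding \<G>_def by auto
    then show "net_content Q \<le> net_content (from_nat_into \<G> n \<inter> Q)"
    proof cases
      case 1
      then have "E m \<inter> Q \<subseteq> from_nat_into \<G> n \<inter> Q" using U(2) by auto
      then show ?thesis using assms(2)[OF Q] content_mono by (meson order_trans)
    next
      case 2
      have "emeasure \<mu> (frontier R) \<le> emeasure \<mu> (dyadic_boundary P)"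
        using 2(1) sets_borel dyadic_boundary_borel by (intro emeasure_mono) (auto simp: dyadic_boundary_eq)
      then show ?thesis
        unfolding 2(2) using boundary_null Q by (intro content_diff_null) auto
    qed
  qed (use INT in auto)
  also have "\<dots> \<le> net_content ((\<Inter>n. E n) \<inter> D)"
    unfolding INT by (rule content_mono) auto
  finally show ?thesis .
qed

end

section \<open>Countable intersections\<close>

theorem theorem2p4:
  fixes P :: "real^'d" and \<mu> :: "(real^'d) measure" and \<theta> :: real
    and E :: "nat \<Rightarrow> (real^'d) set"
  assumes "sets \<mu> = sets borel"
    and "nonatomic \<mu>"
    and "locally_finite_measure \<mu>"
    and "emeasure \<mu> (dyadic_boundary P) = 0"
    and "0 < \<theta>" and "\<theta> \<le> 1"
    and "\<And>n. n \<ge> 1 \<Longrightarrow> E n \<in> large_intersection_class P \<mu> \<theta>"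
  shows "(\<Inter>n\<in>{1..}. E n) \<in> large_intersection_class P \<mu> \<theta>"
proof -
  define F where "F n = E (Suc n)" for n
  have F: "F n \<in> large_intersection_class P \<mu> \<theta>" for n
    unfolding F_def by (rule assms(7)) simp
  have "(\<Inter>n\<in>{1..}. E n) = (\<Inter>n. F n)"
    unfolding F_def by (auto simp: Suc_le_eq gr0_conv_Suc)
  moreover have "(\<Inter>n. F n) \<in> large_intersection_class P \<mu> \<theta>"
    unfolding large_intersection_class_def
  proof (intro CollectI conjI allI impI)
    have gdelta: "gdelta (F n)" for n
      using F by (simp add: large_intersection_class_def)
    then show "gdelta (\<Inter>n. F n)" by (rule gdelta_INT)
    fix \<eta> D assume *: "0 < \<eta> \<and> \<eta> < \<theta> \<and> D \<in> dyadic_cubes P"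
    interpret dyadic_measure P \<mu> \<eta> D
      by unfold_locales (use * assms in auto)
    have "net_content Q = net_content (F n \<inter> Q)" if "Q \<in> subcubes" for n Q
    proof -
      have "Q \<in> dyadic_cubes P" "Q \<subseteq> D" using that by (auto simp: subcubes_def)
      then have "dyadic_content P \<mu> \<eta> (F n \<inter> Q) = dyadic_content P \<mu> \<eta> Q"
        using F[of n] * by (simp add: large_intersection_class_def)
      then show ?thesis
        using \<open>Q \<subseteq> D\<close> by (subst (asm) (1 2) dyadic_content_eq_net_content) auto
    qed
    then have "net_content D \<le> net_content ((\<Inter>n. F n) \<inter> D)"
      using gdelta by (intro content_INT_gdelta) auto
    moreover have "net_content ((\<Inter>n. F n) \<inter> D) \<le> net_content D"
      by (rule content_mono) auto
    ultimately show "dyadic_content P \<mu> \<eta> ((\<Inter>n. F n) \<inter> D) = dyadic_content P \<mu> \<eta> D"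
      by (simp add: dyadic_content_eq_net_content)
  qed
  ultimately show ?thesis by simp
qed

end
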